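(* Let $H$ be a connected graph, let $k$ be a positive integer, and let $n\ge 6\cdot 2^k+k+4$. Then the Cartesian power $H^n$ contains $2^k$ pairwise completely independent spanning trees, each of diameter at most $2(n+5k+1)r(H)+4k+10$.
   Context: The Cartesian power $H^n$ has vertex set $V(H)^n$, where $\mathbf{u}=(u_1,\dots,u_n)$ and $\mathbf{u}'$ are adjacent iff there is $i\in[n]$ with $u_iu'_i\in E(H)$ and $u_j=u'_j$ for all $j\ne i$. The radius of a graph $G$ is $r(G)=\min_{u}\max_{v} d_G(u,v)$. Two spanning trees of a graph $G$ are completely independent if they have no edge in common and, for every pair of vertices $u,v$, the $u$–$v$ paths in the two trees have no vertex in common other than $u$ and $v$. The diameter of a tree is the maximum distance within the tree between two of its vertices. *)

theory Defs
  imports "Graph_Theory.Graph_Theory"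
begin

text \<open>
  A finite simple graph is a \<open>pair_graph\<close>: a finite, loop-free, symmetric relation on a finite
  vertex set, each undirected edge \<open>uv\<close> being the two arcs \<open>(u, v)\<close> and \<open>(v, u)\<close>.
\<close>

text \<open>Coordinates are numbered \<open>0, \<dots>, n - 1\<close>.\<close>

definition cart_power :: "'a pair_pre_digraph \<Rightarrow> nat \<Rightarrow> 'a list pair_pre_digraph" where
  "cart_power H n =
    \<lparr> pverts = {u. set u \<subseteq> pverts H \<and> length u = n},
      parcs = {(u, u'). set u \<subseteq> pverts H \<and> length u = n \<and> set u' \<subseteq> pverts H \<and> length u' = n \<and>
        (\<exists>i<n. (u ! i, u' ! i) \<in> parcs H \<and> (\<forall>j<n. j \<noteq> i \<longrightarrow> u ! j = u' ! j))} \<rparr>"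

text \<open>Meaningful only if \<open>v\<close> is reachable from \<open>u\<close>; otherwise the minimum is over no walks.\<close>

definition graph_dist :: "'a pair_pre_digraph \<Rightarrow> 'a \<Rightarrow> 'a \<Rightarrow> nat" where
  "graph_dist G u v =
    (LEAST l. \<exists>p. vwalk p (with_proj G) \<and> hd p = u \<and> last p = v \<and> vwalk_length p = l)"

definition graph_radius :: "'a pair_pre_digraph \<Rightarrow> nat" where
  "graph_radius G = (MIN u\<in>pverts G. MAX v\<in>pverts G. graph_dist G u v)"

definition graph_diameter :: "'a pair_pre_digraph \<Rightarrow> nat" where
  "graph_diameter G = (MAX (u, v)\<in>pverts G \<times> pverts G. graph_dist G u v)"

text \<open>
  The library's \<open>forest\<close>, \<open>tree\<close> and \<open>spanning_tree\<close> exclude directed cycles only: in a symmetric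
  digraph every edge is a cycle \<open>u, v, u\<close> for them, while an acyclically oriented triangle is a
  tree. So acyclicity is stated here by cycles of the undirected graph, of length at least 3.
\<close>

definition undirected_cycle :: "'a pair_pre_digraph \<Rightarrow> 'a list \<Rightarrow> bool" where
  "undirected_cycle G p \<longleftrightarrow>
    vpath p (with_proj G) \<and> 3 \<le> length p \<and> (last p, hd p) \<in> parcs G"

definition undirected_tree :: "'a pair_pre_digraph \<Rightarrow> bool" where
  "undirected_tree T \<longleftrightarrow>
    pair_graph T \<and> Digraph_Component.connected (with_proj T) \<and> (\<nexists>p. undirected_cycle T p)"

definition undirected_spanning_tree ::
    "'a pair_pre_digraph \<Rightarrow> 'a pair_pre_digraph \<Rightarrow> bool" where
  "undirected_spanning_tree T G \<longleftrightarrow>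
    undirected_tree T \<and> spanning (with_proj T) (with_proj G)"

definition completely_independent ::
    "'a pair_pre_digraph \<Rightarrow> 'a pair_pre_digraph \<Rightarrow> bool" where
  "completely_independent S T \<longleftrightarrow>
    parcs S \<inter> parcs T = {} \<and>
    (\<forall>u v p q. vpath p (with_proj S) \<and> hd p = u \<and> last p = v \<and>
               vpath q (with_proj T) \<and> hd q = u \<and> last q = v \<longrightarrow>
               set p \<inter> set q \<subseteq> {u, v})"

lemma pair_graph_cart_power:
  assumes "pair_graph H"
  shows "pair_graph (cart_power H n)"
proof -
  interpret H: pair_graph H by fact
  let ?V = "{u. set u \<subseteq> pverts H \<and> length u = n}"
  have V: "finite ?V"
    by (rule finite_lists_length_eq) (rule H.pair_finite_verts)
  have sub: "parcs (cart_power H n) \<subseteq> ?V \<times> ?V"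
    by (auto simp: cart_power_def)
  have fin: "finite (parcs (cart_power H n))"
    by (rule finite_subset[OF sub finite_cartesian_product[OF V V]])
  have sym: "(u', u) \<in> parcs (cart_power H n)" if "(u, u') \<in> parcs (cart_power H n)" for u u'
  proof -
    from that obtain i where i: "i < n" "(u ! i, u' ! i) \<in> parcs H"
        "\<forall>j<n. j \<noteq> i \<longrightarrow> u ! j = u' ! j" and uu': "(u, u') \<in> ?V \<times> ?V"
      by (auto simp: cart_power_def)
    from i(2) have "(u' ! i, u ! i) \<in> parcs H"
      by (rule H.arcs_symmetric)
    with i have "\<exists>i<n. (u' ! i, u ! i) \<in> parcs H \<and> (\<forall>j<n. j \<noteq> i \<longrightarrow> u' ! j = u ! j)"
      by (intro exI[of _ i]) simp
    with uu' show ?thesis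
      by (simp add: cart_power_def)
  qed
  have irr: "u \<noteq> u'" if uu': "(u, u') \<in> parcs (cart_power H n)" for u u'
  proof
    assume "u = u'"
    with uu' obtain i where "(u ! i, u ! i) \<in> parcs H"
      by (auto simp: cart_power_def)
    then show False
      using H.pair_no_loops by fastforce
  qed
  have verts: "pverts (cart_power H n) = ?V"
    by (simp add: cart_power_def)
  show ?thesis
  proof
    show "symmetric (with_proj (cart_power H n))"
      unfolding symmetric_def by (intro symI) (simp add: sym)
  qed (use sub fin irr V verts in \<open>fastforce+\<close>)
qed

end

theory Submission
  imports Defs
begin

text \<open>
  It suffices to find \<open>2\<^sup>k\<close> disjoint connected dominating sets (cores) of small radius: a spanning
  tree of a core becomes a spanning tree of the whole power by hanging every other vertex as a leaf
  on a neighbour in the core, and the inner vertices of different trees are then disjoint.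

  Root \<open>H\<close> at its centre and colour its vertices by the parity of their depth. Each vertex of the
  power gets a colour in \<open>{0, 1}\<^sup>k\<close>, namely a Hamming-like syndrome of a block of coordinates, so that
  every other colour is reached by changing a single coordinate. Connectivity of the colour classes
  comes from using two blocks and a control coordinate which says which of them defines the colour:
  while one block is in charge the other can be rearranged to have the same syndrome, after which
  the control can be passed on.
\<close>

section \<open>Walks and distances as powers of the arc relation\<close>

lemma vwalk_nth_arc:
  assumes "vwalk p G" "Suc i < length p"
  shows "(p ! i, p ! Suc i) \<in> arcs_ends G"
  using assms
proof (induction p arbitrary: i rule: vwalk_induct)
  case (Cons u v es)
  then show ?case
    by (cases i) auto
qed simp

lemma vwalk_relpow:
  assumes "vwalk p (with_proj G)"
  shows "(hd p, last p) \<in> parcs G ^^ vwalk_length p"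
  using assms
proof (induction p rule: vwalk_induct)
  case (Cons u v es)
  have "(u, last (v # es)) \<in> parcs G ^^ Suc (vwalk_length (v # es))"
    by (rule relpow_Suc_I2[where y = v]) (use Cons in simp_all)
  then show ?case
    by simp
qed simp

lemma relpow_vwalk:
  assumes "pair_wf_digraph G" "(u, v) \<in> parcs G ^^ l" "u \<in> pverts G"
  shows "\<exists>p. vwalk p (with_proj G) \<and> hd p = u \<and> last p = v \<and> vwalk_length p = l"
  using assms(2,3)
proof (induction l arbitrary: u)
  case 0
  then show ?case
    by (intro exI[of _ "[u]"]) (auto simp: vwalk_def)
next
  case (Suc l)
  from Suc.prems(1) obtain w where w: "(u, w) \<in> parcs G" "(w, v) \<in> parcs G ^^ l"
    by (rule relpow_Suc_E2)
  from w(1) have "w \<in> pverts G"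
    using pair_wf_digraph.in_arcsD2[OF assms(1)] by blast
  from Suc.IH[OF w(2) this] obtain p where p: "vwalk p (with_proj G)" "hd p = w" "last p = v"
    "vwalk_length p = l"
    by blast
  have "p \<noteq> []"
    using p(1) by (auto simp: vwalk_def)
  then show ?case
    using p w(1) Suc.prems(2) by (intro exI[of _ "u # p"]) (auto intro!: vwalk_consI)
qed

text \<open>In this form concatenation of walks is composition of relations, and lengths simply
  add.\<close>

lemma graph_dist_eq_relpow:
  assumes "pair_wf_digraph G" "u \<in> pverts G"
  shows "graph_dist G u v = (LEAST l. (u, v) \<in> parcs G ^^ l)"
proof -
  have "(\<exists>p. vwalk p (with_proj G) \<and> hd p = u \<and> last p = v \<and> vwalk_length p = l) \<longleftrightarrow>
      (u, v) \<in> parcs G ^^ l" for l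
    using vwalk_relpow[of _ G] relpow_vwalk[OF assms(1) _ assms(2), of v l] by metis
  then show ?thesis
    by (simp add: graph_dist_def del: vwalk_length_simp)
qed

lemma graph_dist_le:
  assumes "pair_wf_digraph G" "u \<in> pverts G" "(u, v) \<in> parcs G ^^ l"
  shows "graph_dist G u v \<le> l"
  unfolding graph_dist_eq_relpow[OF assms(1,2)] using assms(3) by (rule Least_le)

lemma relpow_graph_dist:
  assumes "pair_wf_digraph G" "u \<in> pverts G" "(u, v) \<in> (parcs G)\<^sup>*"
  shows "(u, v) \<in> parcs G ^^ graph_dist G u v"
proof -
  obtain l where "(u, v) \<in> parcs G ^^ l"
    using assms(3) by (auto simp: rtrancl_power)
  then show ?thesis
    unfolding graph_dist_eq_relpow[OF assms(1,2)] by (rule LeastI)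
qed

lemma relpow_sym:
  assumes "sym R" "(u, v) \<in> R ^^ l"
  shows "(v, u) \<in> R ^^ l"
  using assms(2)
proof (induction l arbitrary: u)
  case (Suc l)
  from Suc.prems obtain w where "(u, w) \<in> R" "(w, v) \<in> R ^^ l"
    by (rule relpow_Suc_E2)
  then show ?case
    using Suc.IH assms(1) by (auto simp: sym_def)
qed simp

lemma relpow_trans:
  assumes "(u, v) \<in> R ^^ k" "(v, w) \<in> R ^^ l"
  shows "(u, w) \<in> R ^^ (k + l)"
  using assms by (auto simp: relpow_add)

section \<open>Trees given by a parent function\<close>

definition parent_tree :: "'a set \<Rightarrow> 'a \<Rightarrow> ('a \<Rightarrow> 'a) \<Rightarrow> 'a pair_pre_digraph" where
  "parent_tree V x \<pi> = \<lparr> pverts = V,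
     parcs = {(v, w). v \<in> V \<and> w \<in> V \<and> (v \<noteq> x \<and> w = \<pi> v \<or> w \<noteq> x \<and> v = \<pi> w)} \<rparr>"

lemma parent_tree_simps [simp]:
  "pverts (parent_tree V x \<pi>) = V"
  "(v, w) \<in> parcs (parent_tree V x \<pi>) \<longleftrightarrow>
     v \<in> V \<and> w \<in> V \<and> (v \<noteq> x \<and> w = \<pi> v \<or> w \<noteq> x \<and> v = \<pi> w)"
  by (auto simp: parent_tree_def)

text \<open>\<open>lev\<close> need not be the depth: its strict decrease towards the root both
  excludes cycles and bounds the distance to the root.\<close>

locale parent_function =
  fixes V :: "'a set" and x :: 'a and \<pi> :: "'a \<Rightarrow> 'a" and lev :: "'a \<Rightarrow> nat"
  assumes fin: "finite V" and root: "x \<in> V"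
    and parent: "\<lbrakk>v \<in> V; v \<noteq> x\<rbrakk> \<Longrightarrow> \<pi> v \<in> V"
    and lev_parent: "\<lbrakk>v \<in> V; v \<noteq> x\<rbrakk> \<Longrightarrow> lev (\<pi> v) < lev v"
begin

abbreviation T where "T \<equiv> parent_tree V x \<pi>"

lemma pair_graph_T: "pair_graph T"
proof -
  have sub: "parcs T \<subseteq> V \<times> V"
    by auto
  have sym: "symmetric (with_proj T)"
    unfolding symmetric_def by (rule symI) auto
  have noloop: "fst e \<noteq> snd e" if "e \<in> parcs T" for e
    using that lev_parent by (cases e) force
  show ?thesis
  proof
    show "fst e \<in> pverts T" "snd e \<in> pverts T" if "e \<in> parcs T" for e
      using that sub by auto
    show "finite (parcs T)"
      using finite_subset[OF sub] fin by simp
  qed (use sym noloop fin in auto)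
qed

lemma wf_T: "pair_wf_digraph T"
  using pair_graph_T by (simp add: pair_graph_def pair_digraph_def pair_fin_digraph_def)

lemma sym_T: "sym (parcs T)"
  by (rule symI) auto

lemma relpow_root:
  assumes "v \<in> V"
  shows "\<exists>l\<le>lev v. (v, x) \<in> parcs T ^^ l"
  using assms
proof (induction "lev v" arbitrary: v rule: less_induct)
  case less
  show ?case
  proof (cases "v = x")
    case True
    then show ?thesis
      by (intro exI[of _ 0]) simp
  next
    case False
    with less.prems have p: "\<pi> v \<in> V" "lev (\<pi> v) < lev v"
      using parent lev_parent by auto
    from less.hyps[OF p(2,1)] obtain l where l: "l \<le> lev (\<pi> v)" "(\<pi> v, x) \<in> parcs T ^^ l"
      by blast
    have "(v, x) \<in> parcs T ^^ Suc l"
      by (rule relpow_Suc_I2[OF _ l(2)]) (use False less.prems p in auto)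
    with l(1) p(2) show ?thesis
      by (intro exI[of _ "Suc l"]) auto
  qed
qed

lemma relpow_T:
  assumes "u \<in> V" "v \<in> V"
  shows "\<exists>l\<le>lev u + lev v. (u, v) \<in> parcs T ^^ l"
proof -
  obtain l l' where l: "l \<le> lev u" "(u, x) \<in> parcs T ^^ l" "l' \<le> lev v" "(v, x) \<in> parcs T ^^ l'"
    using relpow_root assms by blast
  have "(x, v) \<in> parcs T ^^ l'"
    by (rule relpow_sym[OF sym_T l(4)])
  with l(2) have "(u, v) \<in> parcs T ^^ (l + l')"
    by (auto simp: relpow_add)
  with l show ?thesis
    by (intro exI[of _ "l + l'"]) auto
qed

lemma connected_T: "Digraph_Component.connected (with_proj T)"
proof -
  interpret pair_graph T
    by (rule pair_graph_T)
  have "strongly_connected (with_proj T)"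
  proof (rule strongly_connectedI)
    fix u v
    assume uv: "u \<in> verts (with_proj T)" "v \<in> verts (with_proj T)"
    then have "(u, v) \<in> (parcs T)\<^sup>*"
      using relpow_T[of u v] by (auto simp: rtrancl_power)
    then show "u \<rightarrow>\<^sup>*\<^bsub>with_proj T\<^esub> v"
      using uv by (subst reachable_conv') auto
  qed (use root in auto)
  \<comment> \<open>\<open>connected\<close> speaks of the symmetric closure, which changes nothing
    here.\<close>
  moreover have "mk_symmetric (with_proj T) = T"
    using sym_T by (auto simp: mk_symmetric_def parent_tree_def)
  ultimately show ?thesis
    by (simp add: connected_def)
qed

text \<open>A vertex of maximal level on a cycle would have its parent as both of its neighbours.\<close>

lemma acyclic_T: "\<not> undirected_cycle T p"
proof
  assume "undirected_cycle T p"
  then have p: "vwalk p (with_proj T)" "distinct p" and l: "3 \<le> length p"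
    and closed: "(last p, hd p) \<in> parcs T"
    by (auto simp: undirected_cycle_def vpath_def)
  define l where "l = length p"
  have l3: "3 \<le> l"
    using l by (simp add: l_def)
  have E: "(p ! i, p ! (Suc i mod l)) \<in> parcs T" if "i < l" for i
  proof (cases "Suc i < l")
    case True
    then show ?thesis
      using vwalk_nth_arc[OF p(1), of i] by (simp add: l_def)
  next
    case False
    with that have "l = Suc i"
      by simp
    moreover from this have "p \<noteq> []"
      by (auto simp: l_def)
    moreover from calculation have "last p = p ! i"
      by (simp add: l_def last_conv_nth)
    ultimately show ?thesis
      using closed by (simp add: hd_conv_nth)
  qed
  have "Max ((\<lambda>i. lev (p ! i)) ` {..<l}) \<in> (\<lambda>i. lev (p ! i)) ` {..<l}"
    using l3 by (intro Max_in) (auto simp: lessThan_empty_iff)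
  then obtain i where i: "i < l" "lev (p ! i) = Max ((\<lambda>i. lev (p ! i)) ` {..<l})"
    by auto
  have max: "lev (p ! j) \<le> lev (p ! i)" if "j < l" for j
    unfolding i(2) using that by (intro Max_ge) auto
  define s q where "s = Suc i mod l" and "q = (if i = 0 then l - 1 else i - 1)"
  have sl: "s < l" and ql: "q < l" and qi: "Suc q mod l = i"
    using i(1) l3 by (auto simp: s_def q_def)
  have up: "w = \<pi> (p ! i)" if "(p ! i, w) \<in> parcs T" "lev w \<le> lev (p ! i)" for w
    using that lev_parent by force
  have "p ! s = \<pi> (p ! i)"
    using up[OF _ max[OF sl]] E[OF i(1)] by (simp add: s_def)
  moreover have "p ! q = \<pi> (p ! i)"
    using up[OF _ max[OF ql]] E[OF ql] sym_T by (simp add: qi sym_def)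
  ultimately have "s = q"
    using nth_eq_iff_index_eq[OF p(2), of s q] sl ql by (simp add: l_def)
  \<comment> \<open>The cyclic successor and predecessor of \<open>i\<close> differ because the
    cycle has length at least 3.\<close>
  moreover have "s \<noteq> q"
    using i(1) l3 by (auto simp: s_def q_def mod_Suc)
  ultimately show False
    by simp
qed

lemma undirected_tree_T: "undirected_tree T"
  using pair_graph_T connected_T acyclic_T by (simp add: undirected_tree_def)

lemma diameter_T:
  assumes "\<And>v. v \<in> V \<Longrightarrow> lev v \<le> D"
  shows "graph_diameter T \<le> 2 * D"
proof -
  have "graph_dist T u v \<le> 2 * D" if uv: "u \<in> V" "v \<in> V" for u v
  proof -
    obtain l where "l \<le> lev u + lev v" "(u, v) \<in> parcs T ^^ l"
      using relpow_T[OF uv] by blast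
    then show ?thesis
      using graph_dist_le[OF wf_T, of u v l] assms[OF uv(1)] assms[OF uv(2)] uv(1) by simp
  qed
  then show ?thesis
    unfolding graph_diameter_def using fin root by (intro Max.boundedI) auto
qed

text \<open>A vertex outside \<open>S\<close> is nobody's parent, so it has at most one neighbour,
  its own parent; an inner vertex of a path has two.\<close>

lemma inner_vertex_T:
  assumes S: "\<And>v. \<lbrakk>v \<in> V; v \<noteq> x\<rbrakk> \<Longrightarrow> \<pi> v \<in> S"
    and p: "vpath p (with_proj T)" and w: "w \<in> set p" "w \<noteq> hd p" "w \<noteq> last p"
  shows "w \<in> S"
proof (rule ccontr)
  assume "w \<notin> S"
  from p have walk: "vwalk p (with_proj T)" and dist: "distinct p"
    by (auto simp: vpath_def)
  obtain i where i: "i < length p" "p ! i = w"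
    using w(1) by (auto simp: in_set_conv_nth)
  have "p \<noteq> []"
    using i by auto
  with i(2) w(2,3) have "i \<noteq> 0" "i \<noteq> length p - 1"
    by (metis hd_conv_nth, metis last_conv_nth)
  then obtain j where j: "i = Suc j" "Suc i < length p"
    using i(1) by (cases i) auto
  have "(p ! j, w) \<in> parcs T" "(w, p ! Suc i) \<in> parcs T"
    using vwalk_nth_arc[OF walk, of j] vwalk_nth_arc[OF walk, of i] i j by auto
  then have "p ! j = \<pi> w" "p ! Suc i = \<pi> w"
    using S \<open>w \<notin> S\<close> by auto
  then have "j = Suc i"
    using dist i j by (metis Suc_lessD nth_eq_iff_index_eq)
  with j show False
    by simp
qed

end

text \<open>Breadth-first search: \<open>\<pi> v\<close> is the next vertex on a shortest walk to
  \<open>x\<close>. With \<open>R\<close> restricted to a core, parents stay in the core.\<close>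

lemma shortest_path_parent:
  assumes "\<And>v. v \<in> S \<Longrightarrow> \<exists>l\<le>L. (v, x) \<in> R ^^ l"
  shows "\<exists>\<pi> lev. \<forall>v\<in>S. lev v \<le> L \<and> (v \<noteq> x \<longrightarrow> (v, \<pi> v) \<in> R \<and> lev (\<pi> v) < lev v)"
proof -
  define lev where "lev v = (LEAST l. (v, x) \<in> R ^^ l)" for v
  have lev_le: "lev v \<le> l" if "(v, x) \<in> R ^^ l" for v l
    unfolding lev_def using that by (rule Least_le)
  have lev_relpow: "(v, x) \<in> R ^^ lev v" if "v \<in> S" for v
    unfolding lev_def using assms[OF that] by (elim exE conjE) (rule LeastI)
  have "\<exists>w. (v, w) \<in> R \<and> lev w < lev v" if v: "v \<in> S" "v \<noteq> x" for v
  proof -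
    have "lev v \<noteq> 0"
      using lev_relpow[OF v(1)] v(2) by (intro notI) simp
    then obtain l where l: "lev v = Suc l"
      by (cases "lev v") auto
    then have "(v, x) \<in> R ^^ Suc l"
      using lev_relpow[OF v(1)] by simp
    then obtain w where "(v, w) \<in> R" "(w, x) \<in> R ^^ l"
      by (rule relpow_Suc_E2)
    then show ?thesis
      using lev_le l by (intro exI[of _ w]) (auto simp: less_Suc_eq_le)
  qed
  then obtain \<pi> where "\<And>v. \<lbrakk>v \<in> S; v \<noteq> x\<rbrakk> \<Longrightarrow> (v, \<pi> v) \<in> R \<and> lev (\<pi> v) < lev v"
    by metis
  moreover have "lev v \<le> L" if "v \<in> S" for v
    using assms[OF that] lev_le le_trans by blast
  ultimately show ?thesis
    by (intro exI[of _ \<pi>] exI[of _ lev]) auto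
qed

section \<open>Completely independent spanning trees from connected dominating sets\<close>

text \<open>
  The tree for the core \<open>S i\<close> is a shortest-path tree of the core in which every other vertex \<open>v\<close>
  hangs as a leaf from \<open>f i v\<close>. Its inner vertices lie in \<open>S i\<close>, and an edge between two cores is
  used twice only if \<open>f\<close> selects it from both of its ends.
\<close>

lemma completely_independent_trees_from_cores:
  fixes S :: "nat \<Rightarrow> 'a set"
  assumes G: "pair_graph G"
    and S: "\<And>i. i < m \<Longrightarrow> S i \<subseteq> pverts G"
    and x: "\<And>i. i < m \<Longrightarrow> x i \<in> S i"
    and conn: "\<And>i v. \<lbrakk>i < m; v \<in> S i\<rbrakk> \<Longrightarrow> \<exists>l\<le>L. (v, x i) \<in> (parcs G \<inter> S i \<times> S i) ^^ l"
    and dom: "\<And>i v. \<lbrakk>i < m; v \<in> pverts G; v \<notin> S i\<rbrakk> \<Longrightarrow> f i v \<in> S i \<and> (v, f i v) \<in> parcs G"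
    and disj: "\<And>i j. \<lbrakk>i < m; j < m; i \<noteq> j\<rbrakk> \<Longrightarrow> S i \<inter> S j = {}"
    and orient: "\<And>i j v. \<lbrakk>i < m; j < m; i \<noteq> j; v \<in> S j\<rbrakk> \<Longrightarrow> f j (f i v) \<noteq> v"
  shows "\<exists>T. (\<forall>i<m. undirected_spanning_tree (T i) G \<and> graph_diameter (T i) \<le> 2 * (L + 1)) \<and>
    (\<forall>i<m. \<forall>j<m. i \<noteq> j \<longrightarrow> completely_independent (T i) (T j))"
proof -
  interpret G: pair_graph G
    by (rule G)
  have "\<exists>\<pi> lev. \<forall>v\<in>S i. lev v \<le> L \<and>
      (v \<noteq> x i \<longrightarrow> (v, \<pi> v) \<in> parcs G \<inter> S i \<times> S i \<and> lev (\<pi> v) < lev v)" if "i < m" for i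
    using conn[OF that] by (rule shortest_path_parent)
  then have "\<forall>i. \<exists>\<pi> lev. i < m \<longrightarrow> (\<forall>v\<in>S i. lev v \<le> L \<and>
      (v \<noteq> x i \<longrightarrow> (v, \<pi> v) \<in> parcs G \<inter> S i \<times> S i \<and> lev (\<pi> v) < lev v))"
    by blast
  then obtain \<pi>0 where "\<forall>i. \<exists>lev. i < m \<longrightarrow> (\<forall>v\<in>S i. lev v \<le> L \<and>
      (v \<noteq> x i \<longrightarrow> (v, \<pi>0 i v) \<in> parcs G \<inter> S i \<times> S i \<and> lev (\<pi>0 i v) < lev v))"
    by (rule choice[THEN exE])
  then obtain lev0 where core_all: "\<forall>i. i < m \<longrightarrow> (\<forall>v\<in>S i. lev0 i v \<le> L \<and>
      (v \<noteq> x i \<longrightarrow> (v, \<pi>0 i v) \<in> parcs G \<inter> S i \<times> S i \<and> lev0 i (\<pi>0 i v) < lev0 i v))"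
    by (rule choice[THEN exE])
  have core_lev: "lev0 i v \<le> L" if "i < m" "v \<in> S i" for i v
    using core_all that by blast
  have core: "(v, \<pi>0 i v) \<in> parcs G" "\<pi>0 i v \<in> S i" "lev0 i (\<pi>0 i v) < lev0 i v"
    if "i < m" "v \<in> S i" "v \<noteq> x i" for i v
    using core_all that by blast+
  define \<pi> where "\<pi> i v = (if v \<in> S i then \<pi>0 i v else f i v)" for i v
  \<comment> \<open>Leaves get a level above all levels in the core, so levels still decrease
    towards \<open>f i v\<close>.\<close>
  define lev where "lev i v = (if v \<in> S i then lev0 i v else Suc L)" for i v
  define T where "T i = parent_tree (pverts G) (x i) (\<pi> i)" for i
  have \<pi>: "\<pi> i v \<in> S i" "(v, \<pi> i v) \<in> parcs G" "lev i (\<pi> i v) < lev i v"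
    if "i < m" "v \<in> pverts G" "v \<noteq> x i" for i v
    using core[of i v] dom[of i v] core_lev[of i "f i v"] that
    by (auto simp: \<pi>_def lev_def less_Suc_eq_le)
  have pf: "parent_function (pverts G) (x i) (\<pi> i) (lev i)" if i: "i < m" for i
  proof
    show "finite (pverts G)"
      by (rule G.pair_finite_verts)
    show "x i \<in> pverts G"
      using S x i by auto
    show "\<pi> i v \<in> pverts G" if "v \<in> pverts G" "v \<noteq> x i" for v
      using \<pi>(1)[OF i that] S[OF i] by auto
    show "lev i (\<pi> i v) < lev i v" if "v \<in> pverts G" "v \<noteq> x i" for v
      by (rule \<pi>(3)[OF i that])
  qed
  have tree: "undirected_spanning_tree (T i) G \<and> graph_diameter (T i) \<le> 2 * (L + 1)"
    if i: "i < m" for i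
  proof -
    interpret P: parent_function "pverts G" "x i" "\<pi> i" "lev i"
      by (rule pf[OF i])
    interpret PT: pair_graph P.T
      by (rule P.pair_graph_T)
    have "parcs P.T \<subseteq> parcs G"
      using \<pi>(2)[OF i] G.arcs_symmetric by auto
    then have "spanning (with_proj P.T) (with_proj G)"
      using G.wf_digraph_axioms PT.wf_digraph_axioms
      by (simp add: spanning_def subgraph_def compatible_def)
    moreover have "lev i v \<le> L + 1" for v
      using core_lev[OF i] by (auto simp: lev_def le_Suc_eq)
    ultimately show ?thesis
      using P.undirected_tree_T P.diameter_T[of "L + 1"]
      by (simp add: undirected_spanning_tree_def T_def)
  qed
  have indep: "completely_independent (T i) (T j)" if ij: "i < m" "j < m" "i \<noteq> j" for i j
    unfolding completely_independent_def
  proof (intro conjI allI impI)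
    \<comment> \<open>Parents in \<open>T j\<close> lie in \<open>S j\<close>, which
      \<open>w\<close> does not. So \<open>v\<close> would have to be the parent of \<open>w\<close>
      in \<open>T j\<close>; then both ends select the edge by \<open>f\<close>, against
      \<open>orient\<close>.\<close>
    have arc: False if v: "v \<in> pverts G" "v \<noteq> x i" and w: "\<pi> i v = w" "w \<in> pverts G"
      and T: "(v, w) \<in> parcs (T j)" and ij: "i < m" "j < m" "i \<noteq> j" for v w i j
    proof -
      have wS: "w \<in> S i" "w \<notin> S j"
        using \<pi>(1)[of i v] v w ij disj[of i j] by auto
      from T consider "v \<noteq> x j" "w = \<pi> j v" | "w \<noteq> x j" "v = \<pi> j w"
        by (auto simp: T_def)
      then show False
      proof cases
        case 1
        then show False
          using \<pi>(1)[of j v] wS v ij by auto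
      next
        case 2
        then have "v \<in> S j" "v \<notin> S i"
          using \<pi>(1)[of j w] w ij disj[of i j] by auto
        then show False
          using orient[of i j v] ij w 2 wS by (simp add: \<pi>_def)
      qed
    qed
    show "parcs (T i) \<inter> parcs (T j) = {}"
    proof (rule ccontr)
      assume "parcs (T i) \<inter> parcs (T j) \<noteq> {}"
      then obtain v w where vw: "(v, w) \<in> parcs (T i)" "(v, w) \<in> parcs (T j)"
        by auto
      then have "(w, v) \<in> parcs (T j)"
        by (auto simp: T_def)
      \<comment> \<open>Either end of the edge may be the child in \<open>T i\<close>.\<close>
      with vw show False
        using arc[of v i w j] arc[of w i v j] ij by (auto simp: T_def)
    qed
    fix u v p q
    assume pq: "vpath p (with_proj (T i)) \<and> hd p = u \<and> last p = v \<and>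
      vpath q (with_proj (T j)) \<and> hd q = u \<and> last q = v"
    show "set p \<inter> set q \<subseteq> {u, v}"
    proof
      fix w
      assume w: "w \<in> set p \<inter> set q"
      show "w \<in> {u, v}"
      proof (rule ccontr)
        assume "w \<notin> {u, v}"
        with w pq have "w \<in> S i" "w \<in> S j"
          using parent_function.inner_vertex_T[OF pf[OF ij(1)] \<pi>(1)[OF ij(1)], of p w]
            parent_function.inner_vertex_T[OF pf[OF ij(2)] \<pi>(1)[OF ij(2)], of q w]
          by (auto simp: T_def)
        then show False
          using disj[OF ij] by auto
      qed
    qed
  qed
  show ?thesis
    using tree indep by blast
qed

section \<open>The power of a rooted graph\<close>

text \<open>
  \<open>d\<close> is the distance from the root \<open>\<rho>\<close>, and \<open>flip v\<close> is a neighbour of \<open>v\<close> on the other side of the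
  bipartition of a breadth-first tree. Reading off parities of \<open>d\<close> makes every vertex of the power
  behave like a vertex of the \<open>n\<close>-cube.
\<close>

locale rooted_graph =
  fixes H :: "'a pair_pre_digraph" and \<rho> :: 'a and d :: "'a \<Rightarrow> nat" and flip :: "'a \<Rightarrow> 'a"
    and r n :: nat
  assumes H: "pair_graph H" and root: "\<rho> \<in> pverts H" and d_root: "d \<rho> = 0"
    and walk_root: "v \<in> pverts H \<Longrightarrow> (v, \<rho>) \<in> parcs H ^^ d v"
    and d_le: "v \<in> pverts H \<Longrightarrow> d v \<le> r"
    and flip_arc: "v \<in> pverts H \<Longrightarrow> (v, flip v) \<in> parcs H"
    and flip_parity: "v \<in> pverts H \<Longrightarrow> odd (d (flip v)) \<longleftrightarrow> even (d v)"
    and flip_le: "v \<in> pverts H \<Longrightarrow> d (flip v) \<le> Suc (d v)"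
begin

lemma sym_H: "sym (parcs H)"
proof -
  interpret pair_graph H by (rule H)
  show ?thesis
    using arcs_symmetric by (auto simp: sym_def)
qed

lemma arc_verts: "(v, w) \<in> parcs H \<Longrightarrow> v \<in> pverts H \<and> w \<in> pverts H"
proof -
  interpret pair_graph H by (rule H)
  show "(v, w) \<in> parcs H \<Longrightarrow> v \<in> pverts H \<and> w \<in> pverts H"
    using in_arcsD1 in_arcsD2 by blast
qed

lemma flip_vert: "v \<in> pverts H \<Longrightarrow> flip v \<in> pverts H"
  using flip_arc arc_verts by blast

lemma d_flip_root: "d (flip \<rho>) = 1"
  using flip_parity[OF root] flip_le[OF root] by (cases "d (flip \<rho>)") (auto simp: d_root)

text \<open>The detour through the root separates the cost of the start from that of the target.
  Targets of depth 0 then cost at most \<open>r\<close> per coordinate.\<close>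

lemma walk_between:
  assumes "v \<in> pverts H" "w \<in> pverts H"
  shows "(v, w) \<in> parcs H ^^ (d v + d w)"
  using walk_root[OF assms(1)] relpow_sym[OF sym_H walk_root[OF assms(2)]]
  by (auto simp: relpow_add)

abbreviation P where "P \<equiv> cart_power H n"

abbreviation VP where "VP \<equiv> pverts (cart_power H n)"

lemma length_VP: "u \<in> VP \<Longrightarrow> length u = n"
  by (simp add: cart_power_def)

lemma nth_VP: "u \<in> VP \<Longrightarrow> i < n \<Longrightarrow> u ! i \<in> pverts H"
  by (auto simp: cart_power_def)

lemma VP_I: "length u = n \<Longrightarrow> (\<And>i. i < n \<Longrightarrow> u ! i \<in> pverts H) \<Longrightarrow> u \<in> VP"
  by (auto simp: cart_power_def in_set_conv_nth)

lemma update_VP: "u \<in> VP \<Longrightarrow> x \<in> pverts H \<Longrightarrow> u[i := x] \<in> VP"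
  by (auto simp: cart_power_def dest!: set_update_subset_insert[THEN subsetD])

lemma update_arc:
  assumes "u \<in> VP" "i < n" "(u ! i, x) \<in> parcs H"
  shows "(u, u[i := x]) \<in> parcs P"
proof -
  have "u[i := x] \<in> VP"
    using assms arc_verts update_VP by blast
  then show ?thesis
    using assms by (auto simp: cart_power_def intro!: exI[of _ i])
qed

abbreviation R :: "'a list set \<Rightarrow> ('a list \<times> 'a list) set" where
  "R S \<equiv> parcs P \<inter> S \<times> S"

text \<open>Varying coordinate \<open>i\<close> alone gives a copy of \<open>H\<close>; the walk may
  visit any vertex of it, so the whole copy has to lie in \<open>S\<close>.\<close>

lemma lift_walk:
  assumes "u \<in> VP" "i < n" "\<And>w. w \<in> pverts H \<Longrightarrow> u[i := w] \<in> S"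
    and "(v, w) \<in> parcs H ^^ l"
  shows "(u[i := v], u[i := w]) \<in> R S ^^ l"
  using assms(4)
proof (induction l arbitrary: w)
  case (Suc l)
  from Suc.prems obtain y where y: "(v, y) \<in> parcs H ^^ l" "(y, w) \<in> parcs H"
    by (rule relpow_Suc_E)
  have yw: "y \<in> pverts H" "w \<in> pverts H"
    using arc_verts[OF y(2)] by auto
  have "(u[i := y], u[i := y, i := w]) \<in> parcs P"
    using assms(1,2) y(2) yw by (intro update_arc update_VP) (auto simp: length_VP)
  then have "(u[i := y], u[i := w]) \<in> R S"
    using assms(3) yw by auto
  with Suc.IH[OF y(1)] show ?case
    by (rule relpow_Suc_I)
qed simp

lemma move_coordinate:
  assumes "u \<in> VP" "i < n" "\<And>w. w \<in> pverts H \<Longrightarrow> u[i := w] \<in> S" "y \<in> pverts H"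
  shows "(u, u[i := y]) \<in> R S ^^ (d (u ! i) + d y)"
  using lift_walk[OF assms(1-3) walk_between[OF nth_VP[OF assms(1,2)] assms(4)]] by simp

definition mix :: "nat set \<Rightarrow> 'a list \<Rightarrow> 'a list \<Rightarrow> 'a list" where
  "mix J z u = map (\<lambda>i. if i \<in> J then z ! i else u ! i) [0..<n]"

lemma nth_mix [simp]: "i < n \<Longrightarrow> mix J z u ! i = (if i \<in> J then z ! i else u ! i)"
  by (simp add: mix_def)

lemma length_mix [simp]: "length (mix J z u) = n"
  by (simp add: mix_def)

lemma mix_VP: "z \<in> VP \<Longrightarrow> u \<in> VP \<Longrightarrow> mix J z u \<in> VP"
  by (rule VP_I) (auto simp: nth_VP)

text \<open>The coordinates are moved one after another, and all intermediate vertices agree with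
  \<open>u\<close> outside \<open>J\<close>.\<close>

lemma move_coordinates:
  assumes "finite J" "J \<subseteq> {..<n}" "u \<in> VP" "z \<in> VP"
    and "\<And>w. \<lbrakk>w \<in> VP; \<And>i. \<lbrakk>i < n; i \<notin> J\<rbrakk> \<Longrightarrow> w ! i = u ! i\<rbrakk> \<Longrightarrow> w \<in> S"
  shows "(u, mix J z u) \<in> R S ^^ (\<Sum>j\<in>J. d (u ! j) + d (z ! j))"
  using assms(1,2,5)
proof (induction J rule: finite_induct)
  case empty
  have "mix {} z u = u"
    using assms(3) by (intro nth_equalityI) (auto simp: length_VP)
  then show ?case
    by simp
next
  case (insert j J)
  let ?u = "mix J z u"
  have j: "j < n" "?u ! j = u ! j"
    using insert by auto
  have u: "?u \<in> VP"
    by (rule mix_VP[OF assms(4,3)])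
  have 1: "(u, ?u) \<in> R S ^^ (\<Sum>j\<in>J. d (u ! j) + d (z ! j))"
    by (rule insert.IH) (use insert.prems in auto)
  have 2: "(?u, ?u[j := z ! j]) \<in> R S ^^ (d (?u ! j) + d (z ! j))"
  proof (rule move_coordinate[OF u j(1) _ nth_VP[OF assms(4) j(1)]])
    fix w
    assume "w \<in> pverts H"
    then show "?u[j := w] \<in> S"
      by (intro insert.prems(2) update_VP u) (auto simp: nth_list_update)
  qed
  have "?u[j := z ! j] = mix (insert j J) z u"
    by (rule nth_equalityI) (use insert.hyps j(1) in \<open>auto simp: nth_list_update\<close>)
  with 1 2 j show ?case
    using insert.hyps by (auto simp: relpow_add add.commute[of "d (u ! j) + d (z ! j)"] simp del: add.assoc)
qed

end

section \<open>The cores\<close>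

abbreviation sym_diff :: "'b set \<Rightarrow> 'b set \<Rightarrow> 'b set" where
  "sym_diff A B \<equiv> (A - B) \<union> (B - A)"

text \<open>
  The first \<open>4 * m\<close> coordinates form two blocks, and coordinate \<open>i\<close> carries the label
  \<open>lab (i mod m)\<close>, so that each label occurs twice in each block. The syndrome of a block is the
  symmetric difference of the labels of its coordinates of odd depth. The parity of coordinate
  \<open>4 * m\<close> decides which of the two syndromes determines the core of a vertex; the block that is
  currently not in charge, and all other coordinates, can be changed freely within a core.
\<close>

locale cores = rooted_graph H \<rho> d flip r n
  for H :: "'a pair_pre_digraph" and \<rho> :: 'a and d :: "'a \<Rightarrow> nat" and flip :: "'a \<Rightarrow> 'a"
    and r n :: nat +
  fixes m :: nat and K :: "'c set" and lab :: "nat \<Rightarrow> 'c set"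
  assumes lab: "bij_betw lab {..<m} (Pow K)" and n: "4 * m < n"
begin

definition block :: "bool \<Rightarrow> nat set" where
  "block b = (if b then {2 * m..<4 * m} else {..<2 * m})"

definition mode :: "'a list \<Rightarrow> bool" where
  "mode u \<longleftrightarrow> odd (d (u ! (4 * m)))"

definition syndrome :: "nat set \<Rightarrow> 'a list \<Rightarrow> 'c set" where
  "syndrome I u = {c \<in> K. odd (\<Sum>i\<in>I. if c \<in> lab (i mod m) then d (u ! i) else 0)}"

definition colour :: "'a list \<Rightarrow> 'c set" where
  "colour u = syndrome (block (mode u)) u"

definition core :: "nat \<Rightarrow> 'a list set" where
  "core a = {u \<in> VP. colour u = lab a}"

text \<open>For \<open>a < m\<close>, each block has one coordinate of odd depth, with label
  \<open>lab a\<close>. Hence both syndromes are \<open>lab a\<close>, whichever block is in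
  charge.\<close>

definition centre :: "nat \<Rightarrow> 'a list" where
  "centre a = map (\<lambda>i. if i = a \<or> i = 2 * m + a then flip \<rho> else \<rho>) [0..<n]"

definition index :: "'c set \<Rightarrow> nat" where
  "index = inv_into {..<m} lab"

text \<open>
  Of the two coordinates with the label needed to pass from one core to another, the order of the
  two cores selects one, so that passing forth and passing back use different coordinates.
\<close>

definition switch :: "nat \<Rightarrow> 'a list \<Rightarrow> nat" where
  "switch a u = (if mode u then 2 * m else 0) + (if a < index (colour u) then 0 else m) +
     index (sym_diff (colour u) (lab a))"

definition exit :: "nat \<Rightarrow> 'a list \<Rightarrow> 'a list" where
  "exit a u = u[switch a u := flip (u ! switch a u)]"

section \<open>Syndromes and the passage between cores\<close>

lemma index: "c \<subseteq> K \<Longrightarrow> index c < m" "c \<subseteq> K \<Longrightarrow> lab (index c) = c"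
  unfolding index_def
  using bij_betw_imp_surj_on[OF lab] inv_into_into[of c lab "{..<m}"] f_inv_into_f[of c lab "{..<m}"]
  by auto

lemma index_lab: "a < m \<Longrightarrow> index (lab a) = a"
  unfolding index_def using bij_betw_imp_inj_on[OF lab] by (simp add: inv_into_f_f)

lemma lab_subset: "a < m \<Longrightarrow> lab a \<subseteq> K"
  using bij_betwE[OF lab] by auto

lemma lab_inj: "a < m \<Longrightarrow> b < m \<Longrightarrow> lab a = lab b \<Longrightarrow> a = b"
  using index_lab by metis

lemma syndrome_subset: "syndrome I u \<subseteq> K"
  by (auto simp: syndrome_def)

lemma colour_subset: "colour u \<subseteq> K"
  by (simp add: colour_def syndrome_subset)

lemma syndrome_cong:
  assumes "\<And>i. i \<in> I \<Longrightarrow> u ! i = v ! i"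
  shows "syndrome I u = syndrome I v"
proof -
  have "(\<Sum>i\<in>I. if c \<in> lab (i mod m) then d (u ! i) else 0) =
      (\<Sum>i\<in>I. if c \<in> lab (i mod m) then d (v ! i) else 0)" for c
    by (rule sum.cong) (auto simp: assms)
  then show ?thesis
    by (simp add: syndrome_def)
qed

lemma finite_block: "finite (block b)"
  by (simp add: block_def)

lemma block_less: "i \<in> block b \<Longrightarrow> i < 4 * m"
  by (auto simp: block_def split: if_splits)

lemma block_disjoint: "i \<in> block b \<Longrightarrow> i \<notin> block (\<not> b)"
  by (auto simp: block_def split: if_splits)

text \<open>A flip changes the parity of one depth and so toggles exactly the elements of that
  coordinate's label.\<close>

lemma syndrome_flip:
  assumes u: "u \<in> VP" and i: "i \<in> I" "finite I" "i < n" "lab (i mod m) \<subseteq> K"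
  shows "syndrome I (u[i := flip (u ! i)]) = sym_diff (syndrome I u) (lab (i mod m))"
proof -
  let ?v = "u[i := flip (u ! i)]"
  define g where "g w c j = (if c \<in> lab (j mod m) then d (w ! j) else 0)" for w c j
  have rest: "(\<Sum>j\<in>I - {i}. g ?v c j) = (\<Sum>j\<in>I - {i}. g u c j)" for c
    by (rule sum.cong) (auto simp: g_def)
  have "odd (g ?v c i) \<longleftrightarrow> (odd (g u c i) \<noteq> (c \<in> lab (i mod m)))" for c
    using i u flip_parity[OF nth_VP[OF u i(3)]] by (auto simp: g_def length_VP)
  then have "odd (sum (g ?v c) I) \<longleftrightarrow> (odd (sum (g u c) I) \<noteq> (c \<in> lab (i mod m)))" for c
    using i by (auto simp: sum.remove[of I i] rest)
  moreover have "syndrome I w = {c \<in> K. odd (sum (g w c) I)}" for w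
    by (simp add: syndrome_def g_def)
  ultimately show ?thesis
    using i(4) by auto
qed

lemma switch:
  assumes "a < m"
  shows "switch a u \<in> block (mode u)" "switch a u < 4 * m"
    "lab (switch a u mod m) = sym_diff (colour u) (lab a)"
proof -
  let ?i = "index (sym_diff (colour u) (lab a))"
  have i: "?i < m" "lab ?i = sym_diff (colour u) (lab a)"
    using index[of "sym_diff (colour u) (lab a)"] colour_subset[of u] lab_subset[OF assms] by blast+
  then show "switch a u \<in> block (mode u)"
    by (auto simp: switch_def block_def)
  then show "switch a u < 4 * m"
    by (rule block_less)
  \<comment> \<open>The offsets selecting the block and its half are multiples of
    \<open>m\<close>.\<close>
  have "switch a u = ?i + (if mode u then 2 else 0) * m + (if a < index (colour u) then 0 else 1) * m"
    by (simp add: switch_def)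
  then have "switch a u mod m = ?i"
    using i(1) by simp
  then show "lab (switch a u mod m) = sym_diff (colour u) (lab a)"
    using i(2) by simp
qed

text \<open>The flipped label is the difference between the present and the desired colour. The
  control coordinate is untouched, so the same block stays in charge.\<close>

lemma exit:
  assumes a: "a < m" and u: "u \<in> VP"
  shows "exit a u \<in> core a" "(u, exit a u) \<in> parcs P" "mode (exit a u) = mode u"
proof -
  have i: "switch a u < n"
    using switch(2)[OF a, of u] n by simp
  show mode: "mode (exit a u) = mode u"
    using switch(2)[OF a, of u] by (simp add: mode_def exit_def)
  show "(u, exit a u) \<in> parcs P"
    unfolding exit_def using u i by (intro update_arc flip_arc nth_VP)
  have "colour (exit a u) = sym_diff (colour u) (sym_diff (colour u) (lab a))"
    unfolding colour_def mode unfolding exit_def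
    using syndrome_flip[OF u switch(1)[OF a] finite_block i] switch(3)[OF a, of u]
      colour_subset[of u] lab_subset[OF a]
    by (auto simp: colour_def)
  moreover have "exit a u \<in> VP"
    unfolding exit_def using u i by (intro update_VP flip_vert nth_VP)
  ultimately show "exit a u \<in> core a"
    by (auto simp: core_def)
qed

text \<open>This is the condition \<open>orient\<close> for the trees. Passing back needs the same
  label in the same block, but the comparison of \<open>a\<close> and \<open>b\<close> is reversed
  and selects the other copy.\<close>

lemma exit_exit:
  assumes ab: "a < m" "b < m" "a \<noteq> b" and v: "v \<in> core b"
  shows "exit b (exit a v) \<noteq> v"
proof
  assume eq: "exit b (exit a v) = v"
  let ?w = "exit a v"
  have vV: "v \<in> VP" and cv: "colour v = lab b"
    using v by (auto simp: core_def)
  have w: "colour ?w = lab a" "mode ?w = mode v"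
    using exit[OF ab(1) vV] by (auto simp: core_def)
  have "switch a v \<noteq> switch b ?w"
    using ab by (auto simp: switch_def w cv index_lab Un_commute)
  moreover have i: "switch b ?w < n"
    using switch(2)[OF ab(2), of ?w] n by simp
  \<comment> \<open>Here \<open>exit a v\<close> still agrees with \<open>v\<close>, so this
    coordinate is flipped only once and its parity changes.\<close>
  ultimately have "exit b ?w ! switch b ?w = flip (v ! switch b ?w)"
    using vV by (simp add: exit_def[of b] length_VP) (simp add: exit_def length_VP)
  with eq flip_parity[OF nth_VP[OF vV i]] show False
    by simp
qed

section \<open>Centres of the cores and distances to them\<close>

lemma nth_centre: "i < n \<Longrightarrow> centre a ! i = (if i = a \<or> i = 2 * m + a then flip \<rho> else \<rho>)"
  by (simp add: centre_def)

lemma centre_VP: "centre a \<in> VP"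
  by (rule VP_I) (auto simp: centre_def root flip_vert)

lemma syndrome_centre:
  assumes a: "a < m"
  shows "syndrome (block b) (centre a) = lab a"
proof -
  \<comment> \<open>The only coordinate of \<open>block b\<close> at which the centre has odd depth;
    the syndrome sum collapses to it.\<close>
  define e where "e = (if b then 2 * m + a else a)"
  have e: "e \<in> block b" "e mod m = a"
    using a by (auto simp: e_def block_def)
  have "(\<Sum>i\<in>block b. if c \<in> lab (i mod m) then d (centre a ! i) else 0) =
      (\<Sum>i\<in>block b. if e = i then (if c \<in> lab a then 1 else 0) else 0)" for c
  proof (rule sum.cong)
    fix i
    assume i: "i \<in> block b"
    then have "i < n"
      using block_less n by fastforce
    moreover have "i = a \<or> i = 2 * m + a \<longleftrightarrow> e = i"
      using i a by (auto simp: e_def block_def split: if_splits)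
    ultimately show "(if c \<in> lab (i mod m) then d (centre a ! i) else 0) =
        (if e = i then (if c \<in> lab a then 1 else 0) else 0)"
      using e(2) by (cases "e = i") (simp_all add: nth_centre d_root d_flip_root)
  qed simp
  then show ?thesis
    using e(1) finite_block lab_subset[OF a] by (auto simp: syndrome_def)
qed

lemma centre_core: "a < m \<Longrightarrow> centre a \<in> core a"
  by (simp add: core_def centre_VP colour_def syndrome_centre)

lemma sum_centre_le: "(\<Sum>i<n. d (centre a ! i)) \<le> 2"
proof -
  have "(\<Sum>i<n. d (centre a ! i)) \<le> (\<Sum>i<n. (if a = i then 1 else 0) + (if 2 * m + a = i then 1 else 0))"
    by (rule sum_mono) (auto simp: nth_centre d_root d_flip_root)
  also have "\<dots> \<le> 2"
    by (simp add: sum.distrib)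
  finally show ?thesis .
qed

text \<open>
  Move the coordinates outside the block in charge to their targets, pass the control to the other
  block, move the first block to its target, and reset the control coordinate.
\<close>

lemma core_connected:
  assumes a: "a < m" and u: "u \<in> core a"
  shows "\<exists>l\<le>n * r + 4. (u, centre a) \<in> R (core a) ^^ l"
proof -
  define t where "t = 4 * m"
  define b where "b = mode u"
  \<comment> \<open>A control value of depth at most 1 that puts the other block in charge.\<close>
  define y where "y = (if b then \<rho> else flip \<rho>)"
  define J where "J = {..<n} - block b - {t}"
  let ?z = "centre a"
  have t: "t < n"
    using n by (simp add: t_def)
  have block: "i < n" "i \<noteq> t" if "i \<in> block c" for i c
    using block_less[OF that] n by (auto simp: t_def)
  have y: "y \<in> pverts H" "d y \<le> 1" "odd (d y) \<longleftrightarrow> \<not> b"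
    by (auto simp: y_def root flip_vert d_root d_flip_root)
  have uV: "u \<in> VP" and cu: "syndrome (block b) u = lab a"
    using u by (auto simp: core_def colour_def b_def)
  define u1 where "u1 = mix J ?z u"
  define u2 where "u2 = u1[t := y]"
  define u3 where "u3 = mix (block b) ?z u2"
  have u1: "u1 \<in> VP"
    unfolding u1_def by (rule mix_VP[OF centre_VP uV])
  have u2: "u2 \<in> VP"
    unfolding u2_def by (rule update_VP[OF u1 y(1)])
  have u3: "u3 \<in> VP"
    unfolding u3_def by (rule mix_VP[OF centre_VP u2])
  have other: "i \<in> J" if "i \<in> block (\<not> b)" for i
    using that block block_disjoint[of i "\<not> b"] by (auto simp: J_def)
  have core1: "w \<in> core a" if "w \<in> VP" "mode w = b" "\<And>i. i \<in> block b \<Longrightarrow> w ! i = u ! i" for w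
    using that syndrome_cong[of "block b" w u] cu by (simp add: core_def colour_def)
  have core2: "w \<in> core a"
    if "w \<in> VP" "mode w = (\<not> b)" "\<And>i. i \<in> block (\<not> b) \<Longrightarrow> w ! i = ?z ! i" for w
    using that syndrome_cong[of "block (\<not> b)" w ?z] syndrome_centre[OF a]
    by (simp add: core_def colour_def)
  have 1: "(u, u1) \<in> R (core a) ^^ (\<Sum>j\<in>J. d (u ! j) + d (?z ! j))"
    unfolding u1_def
  proof (rule move_coordinates[OF _ _ uV centre_VP])
    fix w
    assume w: "w \<in> VP" "\<And>i. \<lbrakk>i < n; i \<notin> J\<rbrakk> \<Longrightarrow> w ! i = u ! i"
    show "w \<in> core a"
    proof (rule core1[OF w(1)])
      show "mode w = b"
        using w(2)[OF t] by (simp add: mode_def b_def J_def t_def)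
      show "w ! i = u ! i" if "i \<in> block b" for i
        using w(2)[of i] block[OF that] that by (simp add: J_def)
    qed
  qed (auto simp: J_def)
  have u1t: "u1 ! t = u ! t"
    using t by (simp add: u1_def J_def)
  \<comment> \<open>The control may alternate in parity on its way. This is harmless:
    \<open>block b\<close> has syndrome \<open>lab a\<close> by the colour of \<open>u\<close>, and
    the other block already agrees with the centre.\<close>
  have 2: "(u1, u2) \<in> R (core a) ^^ (d (u ! t) + d y)"
    unfolding u2_def u1t[symmetric]
  proof (rule move_coordinate[OF u1 t _ y(1)])
    fix w
    assume w: "w \<in> pverts H"
    have V: "u1[t := w] \<in> VP"
      by (rule update_VP[OF u1 w])
    show "u1[t := w] \<in> core a"
    proof (cases "mode (u1[t := w]) = b")
      case True
      show ?thesis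
      proof (rule core1[OF V True])
        show "u1[t := w] ! i = u ! i" if "i \<in> block b" for i
          using block[OF that] that by (simp add: u1_def J_def)
      qed
    next
      case False
      then have "mode (u1[t := w]) = (\<not> b)"
        by simp
      then show ?thesis
      proof (rule core2[OF V])
        show "u1[t := w] ! i = ?z ! i" if "i \<in> block (\<not> b)" for i
          using block[OF that] other[OF that] by (simp add: u1_def)
      qed
    qed
  qed
  have u2_block: "u2 ! j = u ! j" if "j \<in> block b" for j
    using block[OF that] that by (simp add: u2_def u1_def J_def)
  have u2t: "u2 ! t = y"
    using u1 t by (simp add: u2_def length_VP)
  have u2_other: "u2 ! i = ?z ! i" if "i \<in> block (\<not> b)" for i
    using block[OF that] other[OF that] by (simp add: u2_def u1_def)
  have "(u2, u3) \<in> R (core a) ^^ (\<Sum>j\<in>block b. d (u2 ! j) + d (?z ! j))"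
    unfolding u3_def
  proof (rule move_coordinates[OF finite_block _ u2 centre_VP])
    fix w
    assume w: "w \<in> VP" "\<And>i. \<lbrakk>i < n; i \<notin> block b\<rbrakk> \<Longrightarrow> w ! i = u2 ! i"
    show "w \<in> core a"
    proof (rule core2[OF w(1)])
      have "w ! t = y"
        using w(2)[OF t] block(2)[of t b] u2t by auto
      then show "mode w = (\<not> b)"
        using y(3) by (simp add: mode_def t_def)
      show "w ! i = ?z ! i" if "i \<in> block (\<not> b)" for i
        using w(2)[of i] block[OF that] block_disjoint[OF that] u2_other[OF that] by simp
    qed
  qed (use block in auto)
  then have 3: "(u2, u3) \<in> R (core a) ^^ (\<Sum>j\<in>block b. d (u ! j) + d (?z ! j))"
    by (simp add: u2_block)
  have u3t: "u3 ! t = y"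
    using t block(2)[of t b] u2t by (auto simp: u3_def)
  have u3_block: "u3 ! i = ?z ! i" if "i \<in> block c" for i c
    using block[OF that] that u2_other[of i] by (cases "c = b") (auto simp: u3_def)
  \<comment> \<open>Both blocks now agree with the centre, so any value of the control is
    allowed.\<close>
  have 4: "(u3, u3[t := \<rho>]) \<in> R (core a) ^^ (d (u3 ! t) + d \<rho>)"
  proof (rule move_coordinate[OF u3 t _ root])
    fix w
    assume w: "w \<in> pverts H"
    have "u3[t := w] ! i = ?z ! i" if "i \<in> block c" for i c
      using block[OF that] u3_block[OF that] by simp
    then have "syndrome (block c) (u3[t := w]) = lab a" for c
      using syndrome_cong[of "block c" "u3[t := w]" ?z] syndrome_centre[OF a] by simp
    then show "u3[t := w] \<in> core a"
      using update_VP[OF u3 w] by (simp add: core_def colour_def)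
  qed
  have end_eq: "u3[t := \<rho>] = ?z"
  proof (rule nth_equalityI)
    fix i
    assume "i < length (u3[t := \<rho>])"
    then have i: "i < n"
      using u3 by (simp add: length_VP)
    consider "i = t" | "i \<in> block b" | "i \<in> J"
      using i by (auto simp: J_def)
    then show "u3[t := \<rho>] ! i = ?z ! i"
    proof cases
      case 1
      then show ?thesis
        \<comment> \<open>As \<open>a < m\<close>, the control coordinate is neither
          \<open>a\<close> nor \<open>2 * m + a\<close>.\<close>
        using t a u3 by (simp add: length_VP nth_centre) (simp add: t_def)
    next
      case 2
      then show ?thesis
        using u3_block[OF 2] block(2)[OF 2] by simp
    next
      case 3
      then show ?thesis
        using i by (simp add: J_def u3_def u2_def u1_def)
    qed
  qed (use u3 in \<open>simp add: length_VP centre_def\<close>)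
  define l where "l = (\<Sum>j\<in>J. d (u ! j) + d (?z ! j)) + (d (u ! t) + d y) +
    (\<Sum>j\<in>block b. d (u ! j) + d (?z ! j)) + (d y + d \<rho>)"
  have "(u, ?z) \<in> R (core a) ^^ l"
    unfolding l_def using relpow_trans[OF relpow_trans[OF relpow_trans[OF 1 2] 3] 4]
    by (simp add: u3t end_eq)
  \<comment> \<open>The depths of \<open>u\<close> contribute at most \<open>n * r\<close>, those of
    the centre at most 2, and moving the control to \<open>y\<close> and away from it at most 2
    more.\<close>
  moreover have "l \<le> n * r + 4"
  proof -
    have split: "{..<n} = insert t (J \<union> block b)"
      using t block by (auto simp: J_def)
    have "(\<Sum>j\<in>J. d (u ! j) + d (?z ! j)) + (\<Sum>j\<in>block b. d (u ! j) + d (?z ! j)) +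
        (d (u ! t) + d (?z ! t)) = (\<Sum>j<n. d (u ! j) + d (?z ! j))"
      unfolding split using finite_block block(2)
      by (subst sum.insert; (subst sum.union_disjoint)?) (auto simp: J_def)
    moreover have "(\<Sum>j<n. d (u ! j)) \<le> (\<Sum>j<n. r)"
      by (rule sum_mono) (use uV in \<open>auto intro: d_le nth_VP\<close>)
    ultimately show ?thesis
      using sum_centre_le[of a] y(2) by (simp add: l_def d_root sum.distrib)
  qed
  ultimately show ?thesis
    by blast
qed

lemma completely_independent_trees:
  "\<exists>T. (\<forall>i<m. undirected_spanning_tree (T i) P \<and> graph_diameter (T i) \<le> 2 * (n * r + 4 + 1)) \<and>
    (\<forall>i<m. \<forall>j<m. i \<noteq> j \<longrightarrow> completely_independent (T i) (T j))"
proof (rule completely_independent_trees_from_cores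
    [where S = core and x = centre and f = exit and L = "n * r + 4"])
  show "pair_graph P"
    by (rule pair_graph_cart_power[OF H])
  show "core i \<inter> core j = {}" if "i < m" "j < m" "i \<noteq> j" for i j
    using that lab_inj by (auto simp: core_def)
  show "core i \<subseteq> VP" for i
    by (auto simp: core_def)
qed (use core_connected centre_core exit exit_exit in auto)

end

section \<open>Rooting a connected graph at its centre\<close>

lemma connected_rtrancl:
  assumes "pair_graph G" "Digraph_Component.connected (with_proj G)" "u \<in> pverts G" "v \<in> pverts G"
  shows "(u, v) \<in> (parcs G)\<^sup>*"
proof -
  interpret pair_graph G
    by (rule assms(1))
  have "strongly_connected (with_proj G)"
    by (rule symmetric_connected_imp_strongly_connected[OF pair_sym_arcs assms(2)])
  then show ?thesis
    using assms(3,4) reachable_rtranclI by (fastforce simp: strongly_connected_def)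
qed

text \<open>A root of least eccentricity bounds all depths by the radius. \<open>flip\<close> steps
  back along a shortest path to the root; the root itself steps to any neighbour, which exists
  because there is a second vertex.\<close>

lemma rooted_graph_at_centre:
  assumes G: "pair_graph G" and conn: "Digraph_Component.connected (with_proj G)"
    and two: "v0 \<in> pverts G" "v1 \<in> pverts G" "v0 \<noteq> v1"
  shows "\<exists>\<rho> d flip. rooted_graph G \<rho> d flip (graph_radius G)"
proof -
  interpret G: pair_graph G
    by (rule G)
  have sym: "sym (parcs G)"
    using G.arcs_symmetric by (auto simp: sym_def)
  have wf: "pair_wf_digraph G"
    by unfold_locales
  let ?ecc = "\<lambda>u. MAX v\<in>pverts G. graph_dist G u v"
  have "graph_radius G \<in> ?ecc ` pverts G"
    unfolding graph_radius_def using two G.pair_finite_verts by (intro Min_in) auto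
  then obtain \<rho> where \<rho>: "\<rho> \<in> pverts G" "graph_radius G = ?ecc \<rho>"
    by auto
  define d where "d = graph_dist G \<rho>"
  have d_walk: "(\<rho>, v) \<in> parcs G ^^ d v" if "v \<in> pverts G" for v
    unfolding d_def by (rule relpow_graph_dist[OF wf \<rho>(1) connected_rtrancl[OF G conn \<rho>(1) that]])
  have d_least: "d v \<le> l" if "(\<rho>, v) \<in> parcs G ^^ l" for v l
    unfolding d_def by (rule graph_dist_le[OF wf \<rho>(1) that])
  have d_root: "d \<rho> = 0"
    using d_least[of \<rho> 0] by simp
  have d_arc: "d w \<le> Suc (d v)" if "(v, w) \<in> parcs G" for v w
    using d_least[OF relpow_Suc_I[OF d_walk that]] G.in_arcsD1[OF that] by simp
  have d_0: "v = \<rho>" if "v \<in> pverts G" "d v = 0" for v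
    using d_walk[OF that(1)] that(2) by simp
  have "\<exists>w. (v, w) \<in> parcs G \<and> (odd (d w) \<longleftrightarrow> even (d v)) \<and> d w \<le> Suc (d v)"
    if v: "v \<in> pverts G" for v
  proof (cases "d v")
    case 0
    then have v\<rho>: "v = \<rho>"
      by (rule d_0[OF v])
    obtain v' where v': "v' \<in> pverts G" "v' \<noteq> v"
      using two by metis
    then have "(v, v') \<in> (parcs G)\<^sup>*"
      by (intro connected_rtrancl[OF G conn v])
    with v'(2) obtain w where w: "(v, w) \<in> parcs G"
      by (metis converse_rtranclE)
    then have "w \<in> pverts G" "w \<noteq> \<rho>"
      using G.in_arcsD2[OF w] G.pair_no_loops[OF w] v\<rho> by auto
    then have "d w \<noteq> 0"
      using d_0 by blast
    then have "d w = 1"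
      using d_arc[OF w] 0 by simp
    with w 0 show ?thesis
      by (intro exI[of _ w]) simp
  next
    case (Suc l)
    then have "(\<rho>, v) \<in> parcs G ^^ Suc l"
      using d_walk[OF v] by simp
    then obtain w where w: "(\<rho>, w) \<in> parcs G ^^ l" "(w, v) \<in> parcs G"
      by (rule relpow_Suc_E)
    \<comment> \<open>The walk to \<open>w\<close> gives one inequality, the arc from
      \<open>w\<close> to \<open>v\<close> the other.\<close>
    have "d w = l"
      using d_least[OF w(1)] d_arc[OF w(2)] Suc by simp
    then show ?thesis
      using w(2) Suc sym by (intro exI[of _ w]) (auto simp: sym_def)
  qed
  then obtain flip where flip: "\<And>v. v \<in> pverts G \<Longrightarrow>
      (v, flip v) \<in> parcs G \<and> (odd (d (flip v)) \<longleftrightarrow> even (d v)) \<and> d (flip v) \<le> Suc (d v)"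
    by metis
  have "rooted_graph G \<rho> d flip (graph_radius G)"
  proof
    show "d v \<le> graph_radius G" if "v \<in> pverts G" for v
      unfolding \<rho>(2) d_def using that G.pair_finite_verts by (intro Max_ge) auto
    show "(v, \<rho>) \<in> parcs G ^^ d v" if "v \<in> pverts G" for v
      by (rule relpow_sym[OF sym d_walk[OF that]])
  qed (use G \<rho>(1) d_root flip in auto)
  then show ?thesis
    by blast
qed

text \<open>With a single vertex there is no \<open>flip\<close>, so this case is separate. Paths
  cannot leave \<open>x\<close>, so the tree is completely independent even of itself.\<close>

lemma completely_independent_trees_singleton:
  assumes G: "pair_graph G" and x: "pverts G = {x}"
  shows "\<exists>T. undirected_spanning_tree T G \<and> graph_diameter T = 0 \<and> completely_independent T T"
proof -
  interpret G: pair_graph G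
    by (rule G)
  have no_arcs: "parcs G = {}"
    using G.in_arcsD1 G.in_arcsD2 G.pair_no_loops x by fastforce
  interpret P: parent_function "pverts G" x id "\<lambda>_. 0"
    by unfold_locales (auto simp: x)
  have "P.T = G"
    using no_arcs x by (auto simp: parent_tree_def)
  moreover have "spanning (with_proj G) (with_proj G)"
    using G.wf_digraph_axioms by (simp add: spanning_def subgraph_def compatible_def)
  moreover have "completely_independent G G"
    unfolding completely_independent_def
  proof (intro conjI allI impI)
    fix u v p q
    assume "vpath p (with_proj G) \<and> hd p = u \<and> last p = v \<and>
      vpath q (with_proj G) \<and> hd q = u \<and> last q = v"
    then have "set p \<subseteq> {x}" "hd p \<in> set p" "hd p = u"
      using x by (auto simp: vpath_def vwalk_def)
    then show "set p \<inter> set q \<subseteq> {u, v}"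
      by auto
  qed (simp add: no_arcs)
  ultimately show ?thesis
    using P.undirected_tree_T P.diameter_T[of 0] by (auto simp: undirected_spanning_tree_def)
qed

section \<open>Choice of the labels and the diameter bound\<close>

theorem theorem6:
  fixes H :: "'a pair_pre_digraph" and k n :: nat
  assumes "pair_graph H"
    and "Digraph_Component.connected (with_proj H)"
    and "k > 0"
    and "n \<ge> 6 * 2 ^ k + k + 4"
  shows "\<exists>T :: nat \<Rightarrow> 'a list pair_pre_digraph.
    (\<forall>i<2 ^ k. undirected_spanning_tree (T i) (cart_power H n) \<and>
       graph_diameter (T i) \<le> 2 * (n + 5 * k + 1) * graph_radius H + 4 * k + 10) \<and>
    (\<forall>i<2 ^ k. \<forall>j<2 ^ k. i \<noteq> j \<longrightarrow> completely_independent (T i) (T j))"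
proof (cases "\<exists>v. pverts H = {v}")
  case True
  then obtain v where v: "pverts H = {v}"
    by blast
  have "pverts (cart_power H n) = {replicate n v}"
    by (auto simp: cart_power_def v subset_eq intro!: replicate_eqI)
  from completely_independent_trees_singleton[OF pair_graph_cart_power[OF assms(1)] this]
  obtain T where "undirected_spanning_tree T (cart_power H n)" "graph_diameter T = 0"
    "completely_independent T T"
    by blast
  then show ?thesis
    \<comment> \<open>The same one-vertex tree serves for every index.\<close>
    by (intro exI[of _ "\<lambda>_. T"]) simp
next
  case False
  moreover have "pverts H \<noteq> {}"
    using assms(2) by (auto simp: connected_conv)
  ultimately obtain v0 v1 where "v0 \<in> pverts H" "v1 \<in> pverts H" "v0 \<noteq> v1"
    by blast
  from rooted_graph_at_centre[OF assms(1,2) this] obtain \<rho> d flip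
    where "rooted_graph H \<rho> d flip (graph_radius H)"
    by blast
  then interpret rooted_graph H \<rho> d flip "graph_radius H" n .
  \<comment> \<open>The labels are all subsets of \<open>{..<k}\<close>, so \<open>m\<close> is
    \<open>2 ^ k\<close>; the blocks and the control fit because
    \<open>4 * 2 ^ k < n\<close>.\<close>
  have "card {..<2 ^ k :: nat} = card (Pow {..<k})"
    by (simp add: card_Pow)
  then obtain lab where lab: "bij_betw lab {..<2 ^ k :: nat} (Pow {..<k})"
    using finite_same_card_bij[of "{..<2 ^ k :: nat}" "Pow {..<k}"] by auto
  interpret cores H \<rho> d flip "graph_radius H" n "2 ^ k" "{..<k}" lab
    by unfold_locales (use lab assms(4) in auto)
  obtain T :: "nat \<Rightarrow> 'a list pair_pre_digraph" where T: "\<forall>i<2 ^ k. undirected_spanning_tree (T i) (cart_power H n) \<and>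
      graph_diameter (T i) \<le> 2 * (n * graph_radius H + 4 + 1)"
    "\<forall>i<2 ^ k. \<forall>j<2 ^ k. i \<noteq> j \<longrightarrow> completely_independent (T i) (T j)"
    using completely_independent_trees by blast
  \<comment> \<open>The constant 10 is twice \<open>4 + 1\<close>: the additive term of the core
    radius and the edge to a leaf.\<close>
  have "2 * (n * graph_radius H + 4 + 1) \<le> 2 * (n + 5 * k + 1) * graph_radius H + 4 * k + 10"
    by (simp add: algebra_simps)
  with T show ?thesis
    by (meson le_trans)
qed

end
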